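(* Let $(V,H,V')$ be a normal triple of Hilbert spaces and let $\mathbf A:V\to V'$ be a bounded linear operator such that for every $F\in V'$ there exists a unique $U=\mathbf A^{-1}F\in V$ with $\mathbf AU=F$, and $\|U\|_V\le C_A\|F\|_{V'}$. Let each $\mathbf M_k$, $k\ge1$, be a bounded linear operator from $V$ to $V'$ with $\|\mathbf A^{-1}\mathbf M_kv\|_V\le C_k\|v\|_V$ for all $v\in V$. Assume in addition that $C_A\le1$ and $C_k\le1$ for all $k$. If $f\in(\mathcal S)_{-1,-\ell}(V')$ for some $\ell>1$, then there exists a unique solution $u\in(\mathcal S)_{-1,-\ell-4}(V)$ of $$\mathbf Au+\sum_{k\ge1}(\mathbf M_ku)\diamond\xi_k=f,$$ and $$\|u\|_{(\mathcal S)_{-1,-\ell-4}(V)}\le C(\ell)\,\|f\|_{(\mathcal S)_{-1,-\ell}(V')},$$ where the number $C(\ell)$ depends only on $\ell$.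
   Context: Wiener chaos. $\mathbb F=(\Omega,\mathcal F,\mathbb P)$ is a complete probability space, $\mathcal U$ a real separable Hilbert space with orthonormal basis $\{\mathfrak u_k\}_{k\ge1}$, $\dot W=\{\dot W(h),h\in\mathcal U\}$ a zero-mean Gaussian family with $\mathbb E(\dot W(h_1)\dot W(h_2))=(h_1,h_2)_{\mathcal U}$, and $\mathcal F$ is generated by $\dot W$. Put $\xi_k=\dot W(\mathfrak u_k)$. $\mathcal J$ is the set of multi-indices $\alpha=(\alpha_1,\alpha_2,\dots)$ of non-negative integers with $|\alpha|=\sum_k\alpha_k<\infty$; $\alpha!=\prod_k\alpha_k!$; $\varepsilon_k$ has $1$ in position $k$ and $0$ elsewhere. $\xi_\alpha=\prod_k H_{\alpha_k}(\xi_k)/\sqrt{\alpha_k!}$, $H_n(x)=(-1)^ne^{x^2/2}\frac{d^n}{dx^n}e^{-x^2/2}$. Kondratiev spaces. For $\rho\le0$, $\ell\le0$ and a Hilbert space $X$, $(\mathcal S)_{\rho,\ell}(X)$ is the space of formal series $v=\sum_\alpha v_\alpha\xi_\alpha$, $v_\alpha\in X$, with $\|v\|^2_{(\mathcal S)_{\rho,\ell}(X)}=\sum_\alpha r_\alpha^2\|v_\alpha\|_X^2<\infty$, where $r_\alpha^2=(\alpha!)^\rho(2\mathbb N)^{\ell\alpha}$ and $(2\mathbb N)^{\ell\alpha}=\prod_{k\ge1}(2k)^{\ell\alpha_k}$. Normal triple: dense continuous embeddings $V\hookrightarrow H\hookrightarrow V'$, $V'$ is the dual of $V$ relative to the inner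 product of $H$, and $|(h,v)_H|\le C\|v\|_V\|h\|_{V'}$ for $v\in V,h\in H$. Solution: $u=\sum_\alpha u_\alpha\xi_\alpha$ is a solution if, for every $\alpha\in\mathcal J$, $\mathbf Au_\alpha+\sum_{k\ge1}\sqrt{\alpha_k}\,\mathbf M_ku_{\alpha-\varepsilon_k}=f_\alpha$ in $V'$ (terms with $\alpha_k=0$ are zero). *)

theory Defs
  imports "HOL-Analysis.Analysis" "HOL-Library.Poly_Mapping"
begin

text \<open>
  Positions are shifted by one: the entry \<open>\<alpha>\<^sub>k\<close>, \<open>k \<ge> 1\<close>, of a multi-index is
  \<open>lookup \<alpha> (k - 1)\<close>, and the operator \<open>M\<^sub>k\<close> is \<open>M (k - 1)\<close>. A formal series
  \<open>v = \<Sum>\<^sub>\<alpha> v\<^sub>\<alpha> \<xi>\<^sub>\<alpha>\<close> is its family of coefficients \<open>\<alpha> \<mapsto> v\<^sub>\<alpha>\<close>.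
\<close>

type_synonym multi_index = "nat \<Rightarrow>\<^sub>0 nat"

definition mi_fact :: "multi_index \<Rightarrow> real" where
  "mi_fact \<alpha> = (\<Prod>k\<in>Poly_Mapping.keys \<alpha>. fact (Poly_Mapping.lookup \<alpha> k))"

text \<open>\<open>(2\<nat>)\<^bsup>q\<alpha>\<^esup> = \<Prod>\<^sub>k (2k)\<^bsup>q\<alpha>\<^sub>k\<^esup>\<close>; with shifted positions the base is \<open>2(k + 1)\<close>.\<close>

definition two_nat_pow :: "real \<Rightarrow> multi_index \<Rightarrow> real" where
  "two_nat_pow q \<alpha> =
     (\<Prod>k\<in>Poly_Mapping.keys \<alpha>. (2 * real (k + 1)) powr (q * real (Poly_Mapping.lookup \<alpha> k)))"

definition kondratiev_weight_sq :: "real \<Rightarrow> real \<Rightarrow> multi_index \<Rightarrow> real" where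
  "kondratiev_weight_sq \<rho> q \<alpha> = mi_fact \<alpha> powr \<rho> * two_nat_pow q \<alpha>"

definition kondratiev :: "real \<Rightarrow> real \<Rightarrow> (multi_index \<Rightarrow> 'x::real_normed_vector) set" where
  "kondratiev \<rho> q = {v. (\<lambda>\<alpha>. kondratiev_weight_sq \<rho> q \<alpha> * (norm (v \<alpha>))\<^sup>2) summable_on UNIV}"

definition kondratiev_norm :: "real \<Rightarrow> real \<Rightarrow> (multi_index \<Rightarrow> 'x::real_normed_vector) \<Rightarrow> real" where
  "kondratiev_norm \<rho> q v =
     sqrt (infsum (\<lambda>\<alpha>. kondratiev_weight_sq \<rho> q \<alpha> * (norm (v \<alpha>))\<^sup>2) UNIV)"

text \<open>
  The maps \<open>i\<close> and \<open>j\<close> are the embeddings \<open>V \<hookrightarrow> H \<hookrightarrow> V'\<close>. That \<open>V'\<close> is the dual of \<open>V\<close>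
  relative to the inner product of \<open>H\<close> means that the functionals \<open>v \<mapsto> (h, v)\<^sub>H\<close>, \<open>h \<in> H\<close>,
  extend to an isomorphism \<open>D\<close> (not necessarily isometric) of \<open>V'\<close> onto the dual of \<open>V\<close>.
\<close>

definition normal_triple ::
  "('v::{real_inner,complete_space} \<Rightarrow> 'h::{real_inner,complete_space}) \<Rightarrow>
   ('h \<Rightarrow> 'w::{real_inner,complete_space}) \<Rightarrow> bool" where
  "normal_triple i j \<longleftrightarrow>
     bounded_linear i \<and> inj i \<and> closure (range i) = UNIV \<and>
     bounded_linear j \<and> inj j \<and> closure (range j) = UNIV \<and>
     (\<exists>D :: 'w \<Rightarrow> ('v \<Rightarrow>\<^sub>L real). bounded_linear D \<and> bij D \<and> bounded_linear (inv D) \<and>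
        (\<forall>h v. blinfun_apply (D (j h)) v = inner h (i v))) \<and>
     (\<exists>C>0. \<forall>h v. \<bar>inner h (i v)\<bar> \<le> C * norm v * norm (j h))"

text \<open>
  Equality of the coefficients of \<open>\<xi>\<^sub>\<alpha>\<close> on both sides of \<open>A u + \<Sum>\<^sub>k (M\<^sub>k u) \<diamond> \<xi>\<^sub>k = f\<close>; the
  positions outside \<open>keys \<alpha>\<close>, where \<open>\<alpha>\<^sub>k = 0\<close>, contribute nothing.
\<close>

definition chaos_solution ::
  "('v \<Rightarrow> 'w::real_normed_vector) \<Rightarrow> (nat \<Rightarrow> 'v \<Rightarrow> 'w) \<Rightarrow>
   (multi_index \<Rightarrow> 'w) \<Rightarrow> (multi_index \<Rightarrow> 'v) \<Rightarrow> bool" where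
  "chaos_solution A M f u \<longleftrightarrow>
     (\<forall>\<alpha>. A (u \<alpha>) + (\<Sum>k\<in>Poly_Mapping.keys \<alpha>.
        sqrt (real (Poly_Mapping.lookup \<alpha> k)) *\<^sub>R M k (u (\<alpha> - Poly_Mapping.single k 1))) = f \<alpha>)"

text \<open>
  An existentially quantified \<open>C(\<ell>)\<close> inside a theorem could depend on the types of the spaces
  \<open>V\<close>, \<open>H\<close>, \<open>V'\<close>; a closed constant depends on \<open>\<ell>\<close> alone. This value comes from
  \<open>\<parallel>u\<^sub>\<alpha>\<parallel> / \<surd>\<alpha>! \<le> \<Sum>\<^bsub>\<beta>+\<gamma>=\<alpha>\<^esub> (|\<beta>|! / \<beta>!) \<parallel>f\<^sub>\<gamma>\<parallel> / \<surd>\<gamma>!\<close>, the bound \<open>|\<beta>|! \<le> \<beta>! (2\<nat>)\<^bsup>2\<beta>\<^esup>\<close>,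
  and Young's and the Cauchy-Schwarz inequality. Both series converge when \<open>\<ell> > 1\<close>.
\<close>

definition kondratiev_const :: "real \<Rightarrow> real" where
  "kondratiev_const l = sqrt (infsum (two_nat_pow (- l)) UNIV * infsum (two_nat_pow (- 4)) UNIV)"

end

theory Submission
  imports Defs
begin

text \<open>
  The equation determines \<open>u\<^sub>\<alpha>\<close> from the \<open>u\<^bsub>\<alpha>-\<epsilon>\<^sub>k\<^esub>\<close>, so by recursion on \<open>|\<alpha>|\<close> there is exactly one
  solution among all formal series. Put \<open>w\<^sub>\<alpha> = \<parallel>u\<^sub>\<alpha>\<parallel> / \<surd>\<alpha>!\<close> and \<open>g\<^sub>\<alpha> = \<parallel>f\<^sub>\<alpha>\<parallel> / \<surd>\<alpha>!\<close>. Since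
  \<open>\<alpha>! = \<alpha>\<^sub>k (\<alpha> - \<epsilon>\<^sub>k)!\<close>, the factors \<open>\<surd>\<alpha>\<^sub>k\<close> cancel and \<open>w\<^sub>\<alpha> \<le> g\<^sub>\<alpha> + \<Sum>\<^sub>k w\<^bsub>\<alpha>-\<epsilon>\<^sub>k\<^esub>\<close>. Because
  \<open>\<Sum>\<^sub>k (2k)\<^sup>-\<^sup>2 \<le> 1\<close>, the weight \<open>P\<^sub>\<beta> = (2\<nat>)\<^bsup>2\<beta>\<^esup>\<close> satisfies \<open>\<Sum>\<^sub>k P\<^bsub>\<beta>-\<epsilon>\<^sub>k\<^esub> \<le> P\<^sub>\<beta>\<close>, whence \<open>w \<le> P * g\<close>
  (convolution). Multiplying by \<open>(2\<nat>)\<^bsup>-(\<ell>/2+2)\<alpha>\<^esup>\<close> turns this into a convolution of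
  \<open>(2\<nat>)\<^bsup>-\<ell>\<beta>/2\<^esup>\<close>, which is square summable, with \<open>(2\<nat>)\<^bsup>-2\<gamma>\<^esup> ((2\<nat>)\<^bsup>-\<ell>\<gamma>/2\<^esup> g\<^sub>\<gamma>)\<close>, which is summable by
  the Cauchy-Schwarz inequality; Young's inequality concludes.
\<close>

section \<open>Multi-indices\<close>

abbreviation unit_index :: "nat \<Rightarrow> multi_index" where
  "unit_index k \<equiv> Poly_Mapping.single k 1"

lemma diff_unit_index_add:
  assumes "k \<in> Poly_Mapping.keys \<alpha>"
  shows "\<alpha> - unit_index k + unit_index k = \<alpha>"
proof (rule poly_mapping_eqI)
  fix j
  show "Poly_Mapping.lookup (\<alpha> - unit_index k + unit_index k) j = Poly_Mapping.lookup \<alpha> j"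
    using assms by (auto simp: lookup_add lookup_minus lookup_single in_keys_iff when_def)
qed

lemma keys_add_multi_index:
  "Poly_Mapping.keys (\<alpha> + \<beta> :: multi_index) = Poly_Mapping.keys \<alpha> \<union> Poly_Mapping.keys \<beta>"
  by (auto simp: in_keys_iff lookup_add)

text \<open>The length of a multi-index; it is the measure for every induction and recursion on
  multi-indices, because removing a unit lowers it by one.\<close>

definition mi_degree :: "multi_index \<Rightarrow> nat" where
  "mi_degree \<alpha> = (\<Sum>k\<in>Poly_Mapping.keys \<alpha>. Poly_Mapping.lookup \<alpha> k)"

lemma mi_degree_diff_unit_index:
  assumes "k \<in> Poly_Mapping.keys \<alpha>"
  shows "mi_degree (\<alpha> - unit_index k) < mi_degree \<alpha>"
proof -
  let ?\<beta> = "\<alpha> - unit_index k"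
  have "mi_degree ?\<beta> = (\<Sum>j\<in>Poly_Mapping.keys \<alpha>. Poly_Mapping.lookup ?\<beta> j)"
    unfolding mi_degree_def
    by (intro sum.mono_neutral_left) (auto simp: in_keys_iff lookup_minus)
  also have "\<dots> < mi_degree \<alpha>"
    unfolding mi_degree_def using assms
    by (intro sum_strict_mono_ex1) (auto simp: lookup_minus lookup_single in_keys_iff when_def)
  finally show ?thesis .
qed

section \<open>Factorials and weights of multi-indices\<close>

lemma mi_fact_pos: "mi_fact \<alpha> > 0"
  by (auto simp: mi_fact_def intro!: prod_pos)

text \<open>Positions outside the support contribute the factor \<open>fact 0 = 1\<close>. This
  allows multi-indices with different supports to be compared over a common index set.\<close>

lemma mi_fact_superset:
  assumes "finite S" "Poly_Mapping.keys \<alpha> \<subseteq> S"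
  shows "mi_fact \<alpha> = (\<Prod>k\<in>S. fact (Poly_Mapping.lookup \<alpha> k))"
  unfolding mi_fact_def using assms
  by (intro prod.mono_neutral_left) (auto simp: in_keys_iff)

lemma mi_fact_add_unit_index:
  "mi_fact (\<beta> + unit_index k) = real (Poly_Mapping.lookup \<beta> k + 1) * mi_fact \<beta>"
proof -
  let ?S = "insert k (Poly_Mapping.keys \<beta>)"
  have "mi_fact (\<beta> + unit_index k) =
      (\<Prod>j\<in>?S. fact (Poly_Mapping.lookup (\<beta> + unit_index k) j))"
    by (rule mi_fact_superset) (auto simp: keys_add_multi_index)
  also have "\<dots> = (\<Prod>j\<in>?S. (if j = k then real (Poly_Mapping.lookup \<beta> k + 1) else 1) *
      fact (Poly_Mapping.lookup \<beta> j))"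
    by (intro prod.cong) (auto simp: lookup_add lookup_single when_def)
  also have "\<dots> = real (Poly_Mapping.lookup \<beta> k + 1) *
      (\<Prod>j\<in>?S. fact (Poly_Mapping.lookup \<beta> j))"
    by (simp only: prod.distrib) (simp add: prod.delta)
  also have "(\<Prod>j\<in>?S. fact (Poly_Mapping.lookup \<beta> j)) = mi_fact \<beta>"
    by (rule mi_fact_superset[symmetric]) auto
  finally show ?thesis .
qed

lemma two_nat_pow_pos: "two_nat_pow q \<alpha> > 0"
  by (auto simp: two_nat_pow_def intro!: prod_pos)

lemma two_nat_pow_superset:
  assumes "finite S" "Poly_Mapping.keys \<alpha> \<subseteq> S"
  shows "two_nat_pow q \<alpha> =
    (\<Prod>k\<in>S. (2 * real (k + 1)) powr (q * real (Poly_Mapping.lookup \<alpha> k)))"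
  unfolding two_nat_pow_def using assms
  by (intro prod.mono_neutral_left) (auto simp: in_keys_iff)

lemma two_nat_pow_0 [simp]: "two_nat_pow q 0 = 1"
  by (simp add: two_nat_pow_def)

lemma two_nat_pow_unit_index [simp]:
  "two_nat_pow q (unit_index k) = (2 * real (k + 1)) powr q"
  by (simp add: two_nat_pow_def)

lemma two_nat_pow_add_index:
  "two_nat_pow q (\<alpha> + \<beta>) = two_nat_pow q \<alpha> * two_nat_pow q \<beta>"
proof -
  let ?S = "Poly_Mapping.keys \<alpha> \<union> Poly_Mapping.keys \<beta>"
  have *: "two_nat_pow q \<gamma> = (\<Prod>k\<in>?S. (2 * real (k + 1)) powr (q * real (Poly_Mapping.lookup \<gamma> k)))"
    if "Poly_Mapping.keys \<gamma> \<subseteq> ?S" for \<gamma>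
    using that by (intro two_nat_pow_superset) auto
  show ?thesis
    by (subst (1 2 3) *)
      (auto simp: keys_add_multi_index lookup_add powr_add distrib_left simp flip: prod.distrib)
qed

lemma two_nat_pow_add_exponent:
  "two_nat_pow (p + q) \<alpha> = two_nat_pow p \<alpha> * two_nat_pow q \<alpha>"
  by (simp add: two_nat_pow_def distrib_right powr_add flip: prod.distrib)

text \<open>Entries outside \<open>K\<close> all vanish. Multi-indices supported in \<open>K\<close>
  thus embed into a product over \<open>K\<close>, where finiteness of boxes and expansion of
  products are available.\<close>

lemma inj_on_restrict_lookup:
  assumes "\<And>\<alpha>. \<alpha> \<in> F \<Longrightarrow> Poly_Mapping.keys \<alpha> \<subseteq> K"
  shows "inj_on (\<lambda>\<alpha>. restrict (Poly_Mapping.lookup \<alpha>) K) F"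
proof (rule inj_onI, rule poly_mapping_eqI)
  fix \<alpha> \<beta> k
  assume F: "\<alpha> \<in> F" "\<beta> \<in> F"
    and eq: "restrict (Poly_Mapping.lookup \<alpha>) K = restrict (Poly_Mapping.lookup \<beta>) K"
  show "Poly_Mapping.lookup \<alpha> k = Poly_Mapping.lookup \<beta> k"
  proof (cases "k \<in> K")
    case True
    then show ?thesis using fun_cong[OF eq, of k] by simp
  next
    case False
    then show ?thesis using assms[OF F(1)] assms[OF F(2)] by (metis in_keys_iff subsetD)
  qed
qed

section \<open>Decompositions of a multi-index\<close>

definition mi_splits :: "multi_index \<Rightarrow> (multi_index \<times> multi_index) set" where
  "mi_splits \<alpha> = {(\<beta>, \<gamma>). \<beta> + \<gamma> = \<alpha>}"

text \<open>The entries of \<open>\<beta>\<close> are bounded by those of \<open>\<alpha>\<close>,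
  which leaves finitely many \<open>\<beta>\<close>; by cancellation \<open>\<beta>\<close>
  determines \<open>\<gamma>\<close>.\<close>

lemma finite_mi_splits: "finite (mi_splits \<alpha>)"
proof -
  let ?K = "Poly_Mapping.keys \<alpha>"
  let ?R = "\<lambda>\<beta>. restrict (Poly_Mapping.lookup \<beta>) ?K"
  let ?B = "fst ` mi_splits \<alpha>"
  have keys: "Poly_Mapping.keys \<beta> \<subseteq> ?K" if "\<beta> \<in> ?B" for \<beta>
    using that by (auto simp: mi_splits_def keys_add_multi_index)
  have "?R ` ?B \<subseteq> (\<Pi>\<^sub>E k\<in>?K. {..Poly_Mapping.lookup \<alpha> k})"
    by (auto simp: mi_splits_def lookup_add)
  then have "finite (?R ` ?B)"
    by (rule finite_subset) (auto intro!: finite_PiE)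
  moreover have "inj_on ?R ?B"
    using keys by (rule inj_on_restrict_lookup)
  ultimately have "finite ?B" by (rule finite_imageD)
  moreover have "inj_on fst (mi_splits \<alpha>)"
    by (auto simp: mi_splits_def inj_on_def)
  ultimately show ?thesis by (rule finite_imageD)
qed

section \<open>Nonnegative series\<close>

lemma nonneg_summable_onI:
  fixes f :: "'a \<Rightarrow> real"
  assumes "\<And>x. f x \<ge> 0" and "\<And>F. finite F \<Longrightarrow> sum f F \<le> B"
  shows "f summable_on UNIV" and "infsum f UNIV \<le> B"
proof -
  show *: "f summable_on UNIV"
    by (rule nonneg_bdd_above_summable_on) (auto intro!: bdd_aboveI[of _ B] assms)
  show "infsum f UNIV \<le> B"
    using * by (rule infsum_le_finite_sums) (auto intro: assms)
qed

lemma sum_le_infsum_nonneg: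
  fixes f :: "'a \<Rightarrow> real"
  assumes "f summable_on UNIV" "\<And>x. f x \<ge> 0" "finite F"
  shows "sum f F \<le> infsum f UNIV"
  using assms by (intro finite_sum_le_infsum) auto

section \<open>The Cauchy-Schwarz and Young inequalities and the summability of the weights\<close>

lemma Cauchy_Schwarz_infsum:
  fixes x y :: "'a \<Rightarrow> real"
  assumes "\<And>a. x a \<ge> 0" "\<And>a. y a \<ge> 0"
    and sx: "(\<lambda>a. (x a)\<^sup>2) summable_on UNIV" and sy: "(\<lambda>a. (y a)\<^sup>2) summable_on UNIV"
  shows "(\<lambda>a. x a * y a) summable_on UNIV"
    and "(\<Sum>\<^sub>\<infinity>a. x a * y a)\<^sup>2 \<le> (\<Sum>\<^sub>\<infinity>a. (x a)\<^sup>2) * (\<Sum>\<^sub>\<infinity>a. (y a)\<^sup>2)"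
proof -
  let ?B = "(\<Sum>\<^sub>\<infinity>a. (x a)\<^sup>2) * (\<Sum>\<^sub>\<infinity>a. (y a)\<^sup>2)"
  have B: "?B \<ge> 0" by (intro mult_nonneg_nonneg infsum_nonneg) auto
  have bound: "(\<Sum>a\<in>F. x a * y a) \<le> sqrt ?B" if "finite F" for F
  proof (rule real_le_rsqrt)
    have "(\<Sum>a\<in>F. x a * y a)\<^sup>2 \<le> (\<Sum>a\<in>F. (x a)\<^sup>2) * (\<Sum>a\<in>F. (y a)\<^sup>2)"
      by (rule Cauchy_Schwarz_ineq_sum)
    also have "\<dots> \<le> ?B"
      using that by (intro mult_mono sum_le_infsum_nonneg sx sy infsum_nonneg sum_nonneg) auto
    finally show "(\<Sum>a\<in>F. x a * y a)\<^sup>2 \<le> ?B" .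
  qed
  have nn: "x a * y a \<ge> 0" for a using assms by simp
  show "(\<lambda>a. x a * y a) summable_on UNIV"
    using nn bound by (rule nonneg_summable_onI)
  have "(\<Sum>\<^sub>\<infinity>a. x a * y a) \<le> sqrt ?B"
    using nn bound by (rule nonneg_summable_onI)
  then have "(\<Sum>\<^sub>\<infinity>a. x a * y a)\<^sup>2 \<le> (sqrt ?B)\<^sup>2"
    using nn by (intro power_mono infsum_nonneg) auto
  then show "(\<Sum>\<^sub>\<infinity>a. x a * y a)\<^sup>2 \<le> ?B" using B by simp
qed

text \<open>The convolution of a square summable with a summable family is square summable:
  Cauchy-Schwarz on each fibre \<open>mi_splits \<alpha>\<close>, with \<open>y\<close> split evenly
  between the two factors, followed by summation over \<open>\<alpha>\<close>.\<close>

lemma Young_convolution: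
  fixes x y :: "multi_index \<Rightarrow> real"
  assumes x: "\<And>a. x a \<ge> 0" and y: "\<And>a. y a \<ge> 0"
    and sx: "(\<lambda>a. (x a)\<^sup>2) summable_on UNIV" and sy: "y summable_on UNIV"
  defines "z \<equiv> \<lambda>\<alpha>. \<Sum>(\<beta>, \<gamma>)\<in>mi_splits \<alpha>. x \<beta> * y \<gamma>"
  shows "(\<lambda>\<alpha>. (z \<alpha>)\<^sup>2) summable_on UNIV"
    and "(\<Sum>\<^sub>\<infinity>\<alpha>. (z \<alpha>)\<^sup>2) \<le> (\<Sum>\<^sub>\<infinity>\<alpha>. (x \<alpha>)\<^sup>2) * (infsum y UNIV)\<^sup>2"
proof -
  let ?X = "\<Sum>\<^sub>\<infinity>\<alpha>. (x \<alpha>)\<^sup>2" and ?Y = "infsum y UNIV"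
  have Y: "?Y \<ge> 0" using y by (intro infsum_nonneg) auto
  have X: "?X \<ge> 0" by (intro infsum_nonneg) auto
  have z: "(z \<alpha>)\<^sup>2 \<le> ?Y * (\<Sum>(\<beta>, \<gamma>)\<in>mi_splits \<alpha>. (x \<beta>)\<^sup>2 * y \<gamma>)" for \<alpha>
  proof -
    have "z \<alpha> = (\<Sum>p\<in>mi_splits \<alpha>. sqrt (y (snd p)) * (x (fst p) * sqrt (y (snd p))))"
      unfolding z_def using y by (intro sum.cong) (auto simp: algebra_simps)
    then have "(z \<alpha>)\<^sup>2 \<le> (\<Sum>p\<in>mi_splits \<alpha>. (sqrt (y (snd p)))\<^sup>2) *
        (\<Sum>p\<in>mi_splits \<alpha>. (x (fst p) * sqrt (y (snd p)))\<^sup>2)"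
      by (simp only: Cauchy_Schwarz_ineq_sum)
    also have "\<dots> = (\<Sum>p\<in>mi_splits \<alpha>. y (snd p)) * (\<Sum>(\<beta>, \<gamma>)\<in>mi_splits \<alpha>. (x \<beta>)\<^sup>2 * y \<gamma>)"
      using y by (simp add: power_mult_distrib case_prod_unfold)
    \<comment> \<open>Within one fibre \<open>\<gamma>\<close> determines \<open>\<beta>\<close>, so
      no value of \<open>y\<close> is counted twice and the total \<open>?Y\<close> is a
      bound.\<close>
    also have "(\<Sum>p\<in>mi_splits \<alpha>. y (snd p)) = sum y (snd ` mi_splits \<alpha>)"
      by (subst sum.reindex) (auto simp: mi_splits_def inj_on_def)
    also have "sum y (snd ` mi_splits \<alpha>) * (\<Sum>(\<beta>, \<gamma>)\<in>mi_splits \<alpha>. (x \<beta>)\<^sup>2 * y \<gamma>) \<le>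
        ?Y * (\<Sum>(\<beta>, \<gamma>)\<in>mi_splits \<alpha>. (x \<beta>)\<^sup>2 * y \<gamma>)"
      using y sy by (intro mult_right_mono sum_le_infsum_nonneg sum_nonneg)
        (auto simp: finite_mi_splits)
    finally show ?thesis .
  qed
  have bound: "(\<Sum>\<alpha>\<in>F. (z \<alpha>)\<^sup>2) \<le> ?X * ?Y\<^sup>2" if F: "finite F" for F
  proof -
    \<comment> \<open>Fibres over distinct \<open>\<alpha>\<close> are disjoint, so the double sum
      runs over a single finite set of pairs. Enlarging that set to the product of its projections
      makes the sum factorize.\<close>
    let ?U = "\<Union>\<alpha>\<in>F. mi_splits \<alpha>"
    have U: "finite ?U" using F finite_mi_splits by auto
    have "(\<Sum>\<alpha>\<in>F. (z \<alpha>)\<^sup>2) \<le> ?Y * (\<Sum>\<alpha>\<in>F. \<Sum>(\<beta>, \<gamma>)\<in>mi_splits \<alpha>. (x \<beta>)\<^sup>2 * y \<gamma>)"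
      unfolding sum_distrib_left by (intro sum_mono) (use z in \<open>simp add: sum_distrib_left\<close>)
    also have "(\<Sum>\<alpha>\<in>F. \<Sum>(\<beta>, \<gamma>)\<in>mi_splits \<alpha>. (x \<beta>)\<^sup>2 * y \<gamma>) = (\<Sum>(\<beta>, \<gamma>)\<in>?U. (x \<beta>)\<^sup>2 * y \<gamma>)"
      using F finite_mi_splits by (intro sum.UNION_disjoint[symmetric]) (auto simp: mi_splits_def)
    also have "\<dots> \<le> (\<Sum>(\<beta>, \<gamma>)\<in>fst ` ?U \<times> snd ` ?U. (x \<beta>)\<^sup>2 * y \<gamma>)"
      using U y by (intro sum_mono2) (auto intro: rev_image_eqI)
    also have "\<dots> = (\<Sum>\<beta>\<in>fst ` ?U. (x \<beta>)\<^sup>2) * sum y (snd ` ?U)"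
      by (simp add: sum_product sum.cartesian_product)
    also have "\<dots> \<le> ?X * ?Y"
      using U X y by (intro mult_mono sum_le_infsum_nonneg sx sy sum_nonneg) auto
    finally have "(\<Sum>\<alpha>\<in>F. (z \<alpha>)\<^sup>2) \<le> ?Y * (?X * ?Y)"
      using Y by (simp add: mult_left_mono)
    then show ?thesis by (simp add: power2_eq_square mult_ac)
  qed
  show "(\<lambda>\<alpha>. (z \<alpha>)\<^sup>2) summable_on UNIV" "(\<Sum>\<^sub>\<infinity>\<alpha>. (z \<alpha>)\<^sup>2) \<le> ?X * ?Y\<^sup>2"
    using bound by (rule nonneg_summable_onI[rotated]; simp)+
qed

text \<open>An Euler product argument: the sum over all multi-indices expands a product of geometric
  series with ratios \<open>x k\<close>, and this product stays bounded because the ratios are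
  summable for \<open>q > 1\<close>.\<close>

lemma summable_two_nat_pow:
  assumes "q > 1"
  shows "two_nat_pow (- q) summable_on UNIV"
proof -
  define x where "x k = (2 * real (k + 1)) powr (- q)" for k
  have x_pos: "x k > 0" for k by (simp add: x_def)
  \<comment> \<open>The bound 1/2 is what makes \<open>1 / (1 - x k) \<le> 1 + 2 * x k\<close> true
    in the geometric estimate below.\<close>
  have x_half: "x k \<le> 1 / 2" for k
  proof -
    have "x k \<le> (2 * real (k + 1)) powr (- 1)"
      unfolding x_def using assms by (intro powr_mono) auto
    also have "\<dots> \<le> 1 / 2" by (simp add: powr_minus field_simps)
    finally show ?thesis .
  qed
  have "summable (\<lambda>k. 2 powr (- q) * real (Suc k) powr (- q))"
    using assms by (intro summable_mult) (subst summable_Suc_iff[of "\<lambda>k. real k powr (- q)"], simp add: summable_real_powr_iff)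
  then have x_summable: "summable x"
    by (simp add: x_def[abs_def] powr_mult[symmetric])
  have geometric: "(\<Sum>j\<le>m. x k ^ j) \<le> exp (2 * x k)" for k m
  proof -
    have "(\<Sum>j\<le>m. x k ^ j) \<le> suminf ((^) (x k))"
      using x_pos[of k] x_half[of k] by (intro sum_le_suminf summable_geometric) auto
    also have "\<dots> = 1 / (1 - x k)"
      using x_pos[of k] x_half[of k] by (intro suminf_geometric) auto
    also have "\<dots> \<le> 1 + 2 * x k"
      using x_pos[of k] x_half[of k] by (simp add: field_simps)
    also have "\<dots> \<le> exp (2 * x k)" by (rule exp_ge_add_one_self)
    finally show ?thesis .
  qed
  show ?thesis
  proof (rule nonneg_summable_onI)
    show "two_nat_pow (- q) \<alpha> \<ge> 0" for \<alpha> using two_nat_pow_pos[of "- q" \<alpha>] by simp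
    fix F :: "multi_index set" assume F: "finite F"
    define K where "K = (\<Union>\<alpha>\<in>F. Poly_Mapping.keys \<alpha>)"
    have K: "finite K" using F by (auto simp: K_def)
    \<comment> \<open>A crude common bound for all entries occurring in \<open>F\<close>, so that
      \<open>F\<close> embeds into a finite box with sides \<open>{..m}\<close>.\<close>
    define m where "m = (\<Sum>\<alpha>\<in>F. \<Sum>k\<in>K. Poly_Mapping.lookup \<alpha> k)"
    let ?R = "\<lambda>\<alpha>. restrict (Poly_Mapping.lookup \<alpha>) K"
    have m: "Poly_Mapping.lookup \<alpha> k \<le> m" if "\<alpha> \<in> F" "k \<in> K" for \<alpha> k
    proof -
      have "Poly_Mapping.lookup \<alpha> k \<le> (\<Sum>k\<in>K. Poly_Mapping.lookup \<alpha> k)"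
        using that K by (intro member_le_sum) auto
      also have "\<dots> \<le> m"
        unfolding m_def using that F
        by (intro member_le_sum[of \<alpha> F "\<lambda>\<alpha>. \<Sum>k\<in>K. Poly_Mapping.lookup \<alpha> k"]) auto
      finally show ?thesis .
    qed
    have inj: "inj_on ?R F"
      by (rule inj_on_restrict_lookup) (auto simp: K_def)
    have "sum (two_nat_pow (- q)) F = (\<Sum>\<alpha>\<in>F. \<Prod>k\<in>K. x k ^ ?R \<alpha> k)"
    proof (rule sum.cong[OF refl])
      fix \<alpha> assume "\<alpha> \<in> F"
      then have "two_nat_pow (- q) \<alpha> =
          (\<Prod>k\<in>K. (2 * real (k + 1)) powr (- q * real (Poly_Mapping.lookup \<alpha> k)))"
        using K by (intro two_nat_pow_superset) (auto simp: K_def)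
      also have "\<dots> = (\<Prod>k\<in>K. x k ^ ?R \<alpha> k)"
        using x_pos
        by (intro prod.cong refl) (simp add: x_def powr_powr flip: powr_realpow)
      finally show "two_nat_pow (- q) \<alpha> = (\<Prod>k\<in>K. x k ^ ?R \<alpha> k)" .
    qed
    also have "\<dots> = (\<Sum>h\<in>?R ` F. \<Prod>k\<in>K. x k ^ h k)"
      using inj by (simp add: sum.reindex)
    also have "\<dots> \<le> (\<Sum>h\<in>(\<Pi>\<^sub>E k\<in>K. {..m}). \<Prod>k\<in>K. x k ^ h k)"
      using K m x_pos
      by (intro sum_mono2 finite_PiE prod_nonneg) (auto intro: less_imp_le)
    \<comment> \<open>Distributivity, read backwards: the sum over the full box is the product of
      truncated geometric series.\<close>
    also have "\<dots> = (\<Prod>k\<in>K. \<Sum>j\<le>m. x k ^ j)"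
      using K by (subst prod_sum_PiE) auto
    also have "\<dots> \<le> (\<Prod>k\<in>K. exp (2 * x k))"
      using x_pos geometric by (intro prod_mono) (auto intro!: sum_nonneg simp: less_imp_le)
    also have "\<dots> = exp (2 * sum x K)"
      using K by (simp add: exp_sum sum_distrib_left)
    also have "\<dots> \<le> exp (2 * suminf x)"
      using x_summable K x_pos by (auto intro!: sum_le_suminf intro: less_imp_le)
    finally show "sum (two_nat_pow (- q)) F \<le> exp (2 * suminf x)" .
  qed
qed

section \<open>The lattice recursion\<close>

text \<open>The full series equals a quarter of the Basel sum, that is
  \<open>pi\<^sup>2 / 24\<close>; the crude bound \<open>pi < 4\<close> suffices.\<close>

lemma sum_inverse_two_nat_square_le_1:
  assumes "finite K"
  shows "(\<Sum>k\<in>K. 1 / (2 * real (k + 1))\<^sup>2) \<le> 1"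
proof -
  have "(\<Sum>k\<in>K. 1 / (real k + 1)\<^sup>2) \<le> pi\<^sup>2 / 6"
    using sum_le_suminf[OF sums_summable[OF inverse_squares_sums] assms]
      sums_unique[OF inverse_squares_sums] by (simp add: add.commute)
  also have "pi\<^sup>2 \<le> 4\<^sup>2" using pi_less_4 by (intro power_mono) auto
  finally have "(\<Sum>k\<in>K. 1 / (real k + 1)\<^sup>2) \<le> 4" by simp
  then have "(\<Sum>k\<in>K. 1 / (real k + 1)\<^sup>2) / 4 \<le> 1" by simp
  then show ?thesis by (simp only: sum_divide_distrib divide_divide_eq_left power_mult_distrib of_nat_add of_nat_1) (simp add: mult.commute)
qed

text \<open>Removing a unit at position \<open>k\<close> divides the weight by
  \<open>(2 * real (k + 1))\<^sup>2\<close>, and the reciprocals of these squares add up to at most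
  1.\<close>

lemma sum_two_nat_pow_predecessors:
  "(\<Sum>k\<in>Poly_Mapping.keys \<beta>. two_nat_pow 2 (\<beta> - unit_index k)) \<le> two_nat_pow 2 \<beta>"
proof -
  have "two_nat_pow 2 (\<beta> - unit_index k) = two_nat_pow 2 \<beta> * (1 / (2 * real (k + 1))\<^sup>2)"
    if "k \<in> Poly_Mapping.keys \<beta>" for k
  proof -
    have "two_nat_pow 2 \<beta> = two_nat_pow 2 (\<beta> - unit_index k) * (2 * real (k + 1)) powr 2"
      using two_nat_pow_add_index[of 2 "\<beta> - unit_index k" "unit_index k"]
      by (simp only: diff_unit_index_add[OF that] two_nat_pow_unit_index)
    moreover have "(2 * real (k + 1)) powr 2 = (2 * real (k + 1))\<^sup>2" by simp
    moreover have "(2 * real (k + 1))\<^sup>2 \<noteq> 0" by simp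
    ultimately show ?thesis by (metis nonzero_mult_div_cancel_right times_divide_eq_right mult_1_right)
  qed
  then have "(\<Sum>k\<in>Poly_Mapping.keys \<beta>. two_nat_pow 2 (\<beta> - unit_index k)) =
      two_nat_pow 2 \<beta> * (\<Sum>k\<in>Poly_Mapping.keys \<beta>. 1 / (2 * real (k + 1))\<^sup>2)"
    unfolding sum_distrib_left by (intro sum.cong) auto
  also have "\<dots> \<le> two_nat_pow 2 \<beta> * 1"
    using two_nat_pow_pos[of 2 \<beta>]
    by (intro mult_left_mono sum_inverse_two_nat_square_le_1) auto
  finally show ?thesis by simp
qed

text \<open>
  Iterating the recursion yields the convolution of \<open>g\<close> with the multinomial coefficients
  \<open>|\<beta>|! / \<beta>!\<close>. They never have to be mentioned: all that matters is that \<open>(2\<nat>)\<^bsup>2\<beta>\<^esup>\<close> is a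
  supersolution of the recursion that defines them.
\<close>

lemma lattice_recursion_bound:
  fixes w g :: "multi_index \<Rightarrow> real"
  assumes g: "\<And>\<alpha>. g \<alpha> \<ge> 0"
    and rec: "\<And>\<alpha>. w \<alpha> \<le> g \<alpha> + (\<Sum>k\<in>Poly_Mapping.keys \<alpha>. w (\<alpha> - unit_index k))"
  shows "w \<alpha> \<le> (\<Sum>(\<beta>, \<gamma>)\<in>mi_splits \<alpha>. two_nat_pow 2 \<beta> * g \<gamma>)"
proof (induction \<alpha> rule: measure_induct_rule[of mi_degree])
  case (less \<alpha>)
  let ?P = "two_nat_pow 2"
  have mem: "(0, \<alpha>) \<in> mi_splits \<alpha>" by (simp add: mi_splits_def)
  have "w \<alpha> \<le> g \<alpha> + (\<Sum>k\<in>Poly_Mapping.keys \<alpha>. w (\<alpha> - unit_index k))"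
    by (rule rec)
  also have "(\<Sum>k\<in>Poly_Mapping.keys \<alpha>. w (\<alpha> - unit_index k)) \<le>
      (\<Sum>k\<in>Poly_Mapping.keys \<alpha>. \<Sum>(\<beta>, \<gamma>)\<in>mi_splits (\<alpha> - unit_index k). ?P \<beta> * g \<gamma>)"
    by (intro sum_mono less.IH mi_degree_diff_unit_index)
  also have "\<dots> = (\<Sum>(k, \<beta>, \<gamma>)\<in>(SIGMA k:Poly_Mapping.keys \<alpha>. mi_splits (\<alpha> - unit_index k)).
      ?P \<beta> * g \<gamma>)"
    by (subst sum.Sigma) (auto simp: finite_mi_splits)
  \<comment> \<open>The removed unit is given back to \<open>\<beta>\<close>: a decomposition of
    \<open>\<alpha> - unit_index k\<close> becomes one of \<open>\<alpha>\<close> with a marked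
    position \<open>k\<close> in the support of its first part.\<close>
  also have "\<dots> = (\<Sum>((\<beta>, \<gamma>), k)\<in>(SIGMA p:mi_splits \<alpha>. Poly_Mapping.keys (fst p)).
      ?P (\<beta> - unit_index k) * g \<gamma>)"
  proof (rule sum.reindex_bij_witness
      [of _ "\<lambda>((\<beta>, \<gamma>), k). (k, \<beta> - unit_index k, \<gamma>)" "\<lambda>(k, \<beta>, \<gamma>). ((\<beta> + unit_index k, \<gamma>), k)"],
      goal_cases)
    case (2 a)
    then obtain \<beta> \<gamma> k where
      a: "a = (k, \<beta>, \<gamma>)" "\<beta> + \<gamma> = \<alpha> - unit_index k" "k \<in> Poly_Mapping.keys \<alpha>"
      by (auto simp: mi_splits_def)
    have "\<beta> + unit_index k + \<gamma> = \<alpha>"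
      using diff_unit_index_add[OF a(3)] by (simp only: a(2)[symmetric] add_ac)
    then show ?case using a(1) by (simp add: mi_splits_def keys_add_multi_index)
  next
    case (4 b)
    then obtain \<beta> \<gamma> k where b: "b = ((\<beta>, \<gamma>), k)" "\<beta> + \<gamma> = \<alpha>" "k \<in> Poly_Mapping.keys \<beta>"
      by (auto simp: mi_splits_def)
    have "\<beta> - unit_index k + \<gamma> + unit_index k = \<alpha>"
      using diff_unit_index_add[OF b(3)] b(2) by (metis add.commute add.assoc)
    then have "\<beta> - unit_index k + \<gamma> = \<alpha> - unit_index k" by (metis add_diff_cancel_right')
    then show ?case using b by (auto simp: mi_splits_def keys_add_multi_index)
  qed (auto simp: diff_unit_index_add simp del: One_nat_def)
  also have "\<dots> = (\<Sum>(\<beta>, \<gamma>)\<in>mi_splits \<alpha>.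
      (\<Sum>k\<in>Poly_Mapping.keys \<beta>. ?P (\<beta> - unit_index k)) * g \<gamma>)"
    by (subst sum.Sigma[symmetric])
      (auto simp: finite_mi_splits case_prod_unfold sum_distrib_right)
  \<comment> \<open>For \<open>\<beta> = 0\<close> the inner sum is empty. The place of this pair is
    later taken by \<open>g \<alpha>\<close>, since \<open>two_nat_pow 2 0 = 1\<close>.\<close>
  also have "\<dots> = (\<Sum>(\<beta>, \<gamma>)\<in>mi_splits \<alpha> - {(0, \<alpha>)}.
      (\<Sum>k\<in>Poly_Mapping.keys \<beta>. ?P (\<beta> - unit_index k)) * g \<gamma>)"
    using mem by (subst sum.remove[OF finite_mi_splits mem]) simp
  also have "\<dots> \<le> (\<Sum>(\<beta>, \<gamma>)\<in>mi_splits \<alpha> - {(0, \<alpha>)}. ?P \<beta> * g \<gamma>)"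
    by (intro sum_mono) (auto intro!: mult_right_mono sum_two_nat_pow_predecessors g simp del: One_nat_def)
  also have "g \<alpha> + \<dots> = (\<Sum>(\<beta>, \<gamma>)\<in>mi_splits \<alpha>. ?P \<beta> * g \<gamma>)"
    using mem by (subst sum.remove[OF finite_mi_splits mem]) simp
  finally show ?case by simp
qed

section \<open>The chaos solution\<close>

text \<open>The coefficient equation solved for its leading term, with \<open>B\<close> in the role
  of the inverse of \<open>A\<close>.\<close>

function chaos_rec ::
  "('w \<Rightarrow> 'v) \<Rightarrow> (nat \<Rightarrow> 'v \<Rightarrow> 'w::real_normed_vector) \<Rightarrow> (multi_index \<Rightarrow> 'w) \<Rightarrow> multi_index \<Rightarrow> 'v"
  where
  "chaos_rec B M f \<alpha> = B (f \<alpha> - (\<Sum>k\<in>Poly_Mapping.keys \<alpha>.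
     sqrt (real (Poly_Mapping.lookup \<alpha> k)) *\<^sub>R M k (chaos_rec B M f (\<alpha> - unit_index k))))"
  by pat_completeness auto
termination
  by (relation "Wellfounded.measure (\<lambda>(B, M, f, \<alpha>). mi_degree \<alpha>)") (use mi_degree_diff_unit_index in auto)

declare chaos_rec.simps [simp del]

text \<open>Existence and uniqueness among all formal series at once, before any question of
  summability: applying the inverse of \<open>A\<close> turns each coefficient equation into the
  recursion.\<close>

lemma chaos_solution_iff:
  fixes A :: "'v \<Rightarrow> 'w::real_normed_vector"
  assumes "bij A"
  shows "chaos_solution A M f u \<longleftrightarrow> u = chaos_rec (inv A) M f"
proof
  assume u: "chaos_solution A M f u"
  have "u \<alpha> = chaos_rec (inv A) M f \<alpha>" for \<alpha>
  proof (induction \<alpha> rule: measure_induct_rule[of mi_degree])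
    case (less \<alpha>)
    let ?S = "\<lambda>u. \<Sum>k\<in>Poly_Mapping.keys \<alpha>.
      sqrt (real (Poly_Mapping.lookup \<alpha> k)) *\<^sub>R M k (u (\<alpha> - unit_index k))"
    have "A (u \<alpha>) = f \<alpha> - ?S u"
      using u by (simp add: chaos_solution_def eq_diff_eq)
    also have "?S u = ?S (chaos_rec (inv A) M f)"
      by (intro sum.cong) (simp_all add: less.IH mi_degree_diff_unit_index del: One_nat_def)
    finally have "inv A (A (u \<alpha>)) = chaos_rec (inv A) M f \<alpha>"
      by (subst chaos_rec.simps) simp
    then show ?case using assms by (simp add: bij_is_inj)
  qed
  then show "u = chaos_rec (inv A) M f" by blast
next
  assume u: "u = chaos_rec (inv A) M f"
  show "chaos_solution A M f u"
    unfolding chaos_solution_def u using assms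
    by (subst chaos_rec.simps) (simp add: bij_is_surj surj_f_inv_f)
qed

text \<open>Norms are taken after applying the inverse of \<open>A\<close> to the coefficient
  equation. The normalization by \<open>sqrt (mi_fact \<alpha>)\<close> absorbs the factors
  \<open>sqrt\<close> of the entries, leaving a recursion with coefficients 1.\<close>

lemma chaos_solution_recursion:
  fixes A :: "'v::real_normed_vector \<Rightarrow> 'w::real_normed_vector"
  assumes "linear A" "bij A"
    and A: "\<And>F. norm (inv A F) \<le> norm F"
    and M: "\<And>k v. norm (inv A (M k v)) \<le> norm v"
    and u: "chaos_solution A M f u"
  defines "w \<equiv> \<lambda>\<alpha>. norm (u \<alpha>) / sqrt (mi_fact \<alpha>)"
  shows "w \<alpha> \<le> norm (f \<alpha>) / sqrt (mi_fact \<alpha>) + (\<Sum>k\<in>Poly_Mapping.keys \<alpha>. w (\<alpha> - unit_index k))"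
proof -
  let ?s = "\<lambda>k. sqrt (real (Poly_Mapping.lookup \<alpha> k))"
  let ?S = "\<Sum>k\<in>Poly_Mapping.keys \<alpha>. ?s k *\<^sub>R M k (u (\<alpha> - unit_index k))"
  \<comment> \<open>Linearity allows the inverse to be moved inside the finite sum, so that the
    bound on \<open>inv A (M k v)\<close> applies termwise.\<close>
  interpret I: linear "inv A"
  proof
    fix x y :: 'w and c :: real
    have inv: "A (inv A x) = x" for x using assms(2) by (simp add: bij_is_surj surj_f_inv_f)
    show "inv A (x + y) = inv A x + inv A y"
      using assms(2) by (intro inv_f_eq) (simp_all add: bij_is_inj linear_add[OF assms(1)] inv)
    show "inv A (c *\<^sub>R x) = c *\<^sub>R inv A x"
      using assms(2) by (intro inv_f_eq) (simp_all add: bij_is_inj linear_cmul[OF assms(1)] inv)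
  qed
  have "A (u \<alpha>) = f \<alpha> - ?S"
    using u by (simp add: chaos_solution_def eq_diff_eq)
  then have "u \<alpha> = inv A (f \<alpha> - ?S)"
    using assms(2) by (metis bij_inv_eq_iff)
  also have "\<dots> = inv A (f \<alpha>) - (\<Sum>k\<in>Poly_Mapping.keys \<alpha>. ?s k *\<^sub>R inv A (M k (u (\<alpha> - unit_index k))))"
    by (simp add: I.diff I.sum I.scale)
  also have "norm \<dots> \<le> norm (inv A (f \<alpha>)) +
      (\<Sum>k\<in>Poly_Mapping.keys \<alpha>. norm (?s k *\<^sub>R inv A (M k (u (\<alpha> - unit_index k)))))"
    by (intro order_trans[OF norm_triangle_ineq4] add_mono norm_sum) simp
  also have "\<dots> \<le> norm (f \<alpha>) + (\<Sum>k\<in>Poly_Mapping.keys \<alpha>. ?s k * norm (u (\<alpha> - unit_index k)))"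
    by (intro add_mono sum_mono A) (simp add: M mult_left_mono)
  finally have "w \<alpha> \<le>
      (norm (f \<alpha>) + (\<Sum>k\<in>Poly_Mapping.keys \<alpha>. ?s k * norm (u (\<alpha> - unit_index k)))) / sqrt (mi_fact \<alpha>)"
    unfolding w_def using mi_fact_pos[of \<alpha>] by (intro divide_right_mono) auto
  also have "\<dots> = norm (f \<alpha>) / sqrt (mi_fact \<alpha>) +
      (\<Sum>k\<in>Poly_Mapping.keys \<alpha>. ?s k * norm (u (\<alpha> - unit_index k)) / sqrt (mi_fact \<alpha>))"
    by (simp add: add_divide_distrib sum_divide_distrib)
  also have "(\<Sum>k\<in>Poly_Mapping.keys \<alpha>. ?s k * norm (u (\<alpha> - unit_index k)) / sqrt (mi_fact \<alpha>)) =
      (\<Sum>k\<in>Poly_Mapping.keys \<alpha>. w (\<alpha> - unit_index k))"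
  proof (rule sum.cong[OF refl])
    fix k assume k: "k \<in> Poly_Mapping.keys \<alpha>"
    have "mi_fact \<alpha> = real (Poly_Mapping.lookup \<alpha> k) * mi_fact (\<alpha> - unit_index k)"
      using mi_fact_add_unit_index[of "\<alpha> - unit_index k" k] k
      by (simp only: diff_unit_index_add[OF k]) (simp add: lookup_minus in_keys_iff)
    moreover have "?s k > 0" using k by (simp add: in_keys_iff)
    ultimately show "?s k * norm (u (\<alpha> - unit_index k)) / sqrt (mi_fact \<alpha>) = w (\<alpha> - unit_index k)"
      unfolding w_def by (simp add: real_sqrt_mult)
  qed
  finally show ?thesis .
qed

section \<open>The estimate in Kondratiev norms\<close>

lemma kondratiev_summand:
  "kondratiev_weight_sq (-1) (2 * q) \<alpha> * (norm v)\<^sup>2 =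
     (two_nat_pow q \<alpha> * (norm v / sqrt (mi_fact \<alpha>)))\<^sup>2"
  using mi_fact_pos[of \<alpha>] two_nat_pow_add_exponent[of q q \<alpha>]
  by (simp add: kondratiev_weight_sq_def powr_minus power_mult_distrib power_divide
      power2_eq_square[of "two_nat_pow q \<alpha>"] field_simps)

lemma kondratiev_estimate:
  fixes f :: "multi_index \<Rightarrow> 'w::real_normed_vector" and u :: "multi_index \<Rightarrow> 'v::real_normed_vector"
  assumes "l > 1" and f: "f \<in> kondratiev (-1) (- l)"
    and rec: "\<And>\<alpha>. norm (u \<alpha>) / sqrt (mi_fact \<alpha>) \<le> norm (f \<alpha>) / sqrt (mi_fact \<alpha>) +
      (\<Sum>k\<in>Poly_Mapping.keys \<alpha>. norm (u (\<alpha> - unit_index k)) / sqrt (mi_fact (\<alpha> - unit_index k)))"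
  shows "u \<in> kondratiev (-1) (- l - 4)"
    and "kondratiev_norm (-1) (- l - 4) u \<le> kondratiev_const l * kondratiev_norm (-1) (- l) f"
proof -
  let ?w = "\<lambda>\<alpha>. norm (u \<alpha>) / sqrt (mi_fact \<alpha>)" and ?g = "\<lambda>\<alpha>. norm (f \<alpha>) / sqrt (mi_fact \<alpha>)"
  let ?U = "\<lambda>\<alpha>. kondratiev_weight_sq (-1) (- l - 4) \<alpha> * (norm (u \<alpha>))\<^sup>2"
  let ?F = "\<lambda>\<alpha>. kondratiev_weight_sq (-1) (- l) \<alpha> * (norm (f \<alpha>))\<^sup>2"
  \<comment> \<open>Half of the exponent \<open>- l\<close> is used because the summands of the
    norms are squares: \<open>x\<close> is square summable, and \<open>x\<close> times the
    normalized norm of \<open>f\<close> has the squared norm of \<open>f\<close> as its sum of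
    squares.\<close>
  define x where "x = two_nat_pow (- l / 2)"
  define y where "y \<alpha> = two_nat_pow (- 2) \<alpha> * (x \<alpha> * ?g \<alpha>)" for \<alpha>
  define z where "z \<alpha> = (\<Sum>(\<beta>, \<gamma>)\<in>mi_splits \<alpha>. x \<beta> * y \<gamma>)" for \<alpha>
  have T: "two_nat_pow q \<alpha> \<ge> 0" for q \<alpha> using two_nat_pow_pos[of q \<alpha>] by simp
  have T2: "(two_nat_pow q \<alpha>)\<^sup>2 = two_nat_pow (2 * q) \<alpha>" for q \<alpha>
    using two_nat_pow_add_exponent[of q q \<alpha>] by (simp add: power2_eq_square)
  have x: "x \<alpha> \<ge> 0" for \<alpha> by (simp add: x_def T)
  have g: "?g \<alpha> \<ge> 0" for \<alpha> using mi_fact_pos[of \<alpha>] by simp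
  have y: "y \<alpha> \<ge> 0" for \<alpha> unfolding y_def by (intro mult_nonneg_nonneg T x g)
  have x2: "(\<lambda>\<alpha>. (x \<alpha>)\<^sup>2) = two_nat_pow (- l)"
    by (simp add: x_def T2)
  have F: "?F = (\<lambda>\<alpha>. (x \<alpha> * ?g \<alpha>)\<^sup>2)"
    using kondratiev_summand[of "- l / 2" _ "f _"] by (simp add: x_def fun_eq_iff)
  have sF: "(\<lambda>\<alpha>. (x \<alpha> * ?g \<alpha>)\<^sup>2) summable_on UNIV"
    using f unfolding kondratiev_def mem_Collect_eq F .
  have sx: "(\<lambda>\<alpha>. (x \<alpha>)\<^sup>2) summable_on UNIV"
    unfolding x2 using \<open>l > 1\<close> by (rule summable_two_nat_pow)
  have T4: "(\<lambda>\<alpha>. (two_nat_pow (- 2) \<alpha>)\<^sup>2) = two_nat_pow (- 4)"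
    by (simp add: T2)
  have s4: "(\<lambda>\<alpha>. (two_nat_pow (- 2) \<alpha>)\<^sup>2) summable_on UNIV"
    unfolding T4 by (rule summable_two_nat_pow) simp
  have xg: "x \<alpha> * ?g \<alpha> \<ge> 0" for \<alpha> by (intro mult_nonneg_nonneg x g)
  \<comment> \<open>The extra factor \<open>two_nat_pow (- 2)\<close> turns square summability into
    summability, at the price of the second series in \<open>kondratiev_const\<close>.\<close>
  have sy: "y summable_on UNIV"
    and y2: "(infsum y UNIV)\<^sup>2 \<le> infsum (two_nat_pow (- 4)) UNIV * infsum ?F UNIV"
    using Cauchy_Schwarz_infsum[OF T xg s4 sF] unfolding y_def[symmetric] T4 F by auto
  have sz: "(\<lambda>\<alpha>. (z \<alpha>)\<^sup>2) summable_on UNIV"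
    and z2: "(\<Sum>\<^sub>\<infinity>\<alpha>. (z \<alpha>)\<^sup>2) \<le> infsum (two_nat_pow (- l)) UNIV * (infsum y UNIV)\<^sup>2"
    using Young_convolution[OF x y sx sy] unfolding z_def x2 by auto
  have Uz: "?U \<alpha> \<le> (z \<alpha>)\<^sup>2" for \<alpha>
  proof -
    have "?U \<alpha> = (two_nat_pow (- l / 2 - 2) \<alpha> * ?w \<alpha>)\<^sup>2"
      using kondratiev_summand[of "- l / 2 - 2" \<alpha> "u \<alpha>"] by simp
    also have "\<dots> \<le> (z \<alpha>)\<^sup>2"
    proof (rule power_mono)
      have "two_nat_pow (- l / 2 - 2) \<alpha> * ?w \<alpha> \<le>
          two_nat_pow (- l / 2 - 2) \<alpha> * (\<Sum>(\<beta>, \<gamma>)\<in>mi_splits \<alpha>. two_nat_pow 2 \<beta> * ?g \<gamma>)"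
        using lattice_recursion_bound[of ?g ?w \<alpha>, OF g rec] T by (intro mult_left_mono) auto
      also have "\<dots> = z \<alpha>"
        unfolding z_def sum_distrib_left
      \<comment> \<open>The weight of \<open>\<alpha>\<close> is multiplicative over a
        decomposition. The part \<open>- 2\<close> of its exponent cancels
        \<open>two_nat_pow 2 \<beta>\<close> on the first component and becomes the summability
        factor of \<open>y\<close> on the second.\<close>
      proof (rule sum.cong[OF refl], clarify)
        fix \<beta> \<gamma> assume "(\<beta>, \<gamma>) \<in> mi_splits \<alpha>"
        then have "two_nat_pow (- l / 2 - 2) \<alpha> =
            two_nat_pow (- l / 2 - 2) \<beta> * two_nat_pow (- l / 2 - 2) \<gamma>"
          by (auto simp: mi_splits_def two_nat_pow_add_index)
        moreover have "two_nat_pow (- l / 2 - 2) \<beta> * two_nat_pow 2 \<beta> = x \<beta>"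
          by (simp add: x_def flip: two_nat_pow_add_exponent)
        moreover have "two_nat_pow (- l / 2 - 2) \<gamma> = x \<gamma> * two_nat_pow (- 2) \<gamma>"
          by (simp add: x_def flip: two_nat_pow_add_exponent)
        ultimately show "two_nat_pow (- l / 2 - 2) \<alpha> * (two_nat_pow 2 \<beta> * ?g \<gamma>) = x \<beta> * y \<gamma>"
          by (simp add: y_def mult_ac)
      qed
      finally show "two_nat_pow (- l / 2 - 2) \<alpha> * ?w \<alpha> \<le> z \<alpha>" .
      show "0 \<le> two_nat_pow (- l / 2 - 2) \<alpha> * ?w \<alpha>"
        using T[of "- l / 2 - 2" \<alpha>] mi_fact_pos[of \<alpha>] by simp
    qed
    finally show ?thesis .
  qed
  have sU: "?U summable_on UNIV"
    using sz
  proof (rule summable_on_comparison_test)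
    show "?U \<alpha> \<le> (z \<alpha>)\<^sup>2" for \<alpha> by (rule Uz)
    show "0 \<le> ?U \<alpha>" for \<alpha> by (simp add: kondratiev_weight_sq_def T)
  qed
  then show "u \<in> kondratiev (-1) (- l - 4)" by (simp add: kondratiev_def)
  have "infsum ?U UNIV \<le> (\<Sum>\<^sub>\<infinity>\<alpha>. (z \<alpha>)\<^sup>2)"
    using sU sz Uz by (intro infsum_mono) auto
  also note z2
  also have "infsum (two_nat_pow (- l)) UNIV * (infsum y UNIV)\<^sup>2 \<le>
      infsum (two_nat_pow (- l)) UNIV * (infsum (two_nat_pow (- 4)) UNIV * infsum ?F UNIV)"
    by (intro mult_left_mono y2 infsum_nonneg T)
  finally show "kondratiev_norm (-1) (- l - 4) u \<le> kondratiev_const l * kondratiev_norm (-1) (- l) f"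
    unfolding kondratiev_norm_def kondratiev_const_def real_sqrt_mult[symmetric]
    by (simp add: mult.assoc)
qed

theorem theorem6:
  fixes i :: "'v::{real_inner,complete_space} \<Rightarrow> 'h::{real_inner,complete_space}"
    and j :: "'h \<Rightarrow> 'w::{real_inner,complete_space}"
    and A :: "'v \<Rightarrow> 'w"
    and M :: "nat \<Rightarrow> 'v \<Rightarrow> 'w"
    and C\<^sub>A :: real and C :: "nat \<Rightarrow> real"
    and l :: real
    and f :: "multi_index \<Rightarrow> 'w"
  assumes "normal_triple i j"
    and "bounded_linear A"
    and "\<forall>F. \<exists>!U. A U = F"
    and "\<forall>F. norm (inv A F) \<le> C\<^sub>A * norm F"
    and "\<forall>k. bounded_linear (M k)"
    and "\<forall>k v. norm (inv A (M k v)) \<le> C k * norm v"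
    and "C\<^sub>A \<le> 1"
    and "\<forall>k. C k \<le> 1"
    and "l > 1"
    and "f \<in> kondratiev (-1) (- l)"
  shows "(\<exists>!u. u \<in> kondratiev (-1) (- l - 4) \<and> chaos_solution A M f u) \<and>
         (\<forall>u. u \<in> kondratiev (-1) (- l - 4) \<and> chaos_solution A M f u \<longrightarrow>
            kondratiev_norm (-1) (- l - 4) u
              \<le> kondratiev_const l * kondratiev_norm (-1) (- l) f)"
proof -
  have bij: "bij A" using assms(3) by (metis bij_iff)
  have lin: "linear A" using assms(2) by (rule bounded_linear.linear)
  have A: "norm (inv A F) \<le> norm F" for F
  proof -
    have "C\<^sub>A * norm F \<le> 1 * norm F" using assms(7) by (intro mult_right_mono) auto
    then show ?thesis using assms(4)[rule_format, of F] by simp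
  qed
  have M: "norm (inv A (M k v)) \<le> norm v" for k v
  proof -
    have "C k * norm v \<le> 1 * norm v" using assms(8) by (intro mult_right_mono) auto
    then show ?thesis using assms(6)[rule_format, of k v] by simp
  qed
  have rec: "norm (u \<alpha>) / sqrt (mi_fact \<alpha>) \<le> norm (f \<alpha>) / sqrt (mi_fact \<alpha>) +
      (\<Sum>k\<in>Poly_Mapping.keys \<alpha>. norm (u (\<alpha> - unit_index k)) / sqrt (mi_fact (\<alpha> - unit_index k)))"
    if "chaos_solution A M f u" for u \<alpha>
    using lin bij A M that by (rule chaos_solution_recursion)
  have est: "u \<in> kondratiev (-1) (- l - 4)"
      "kondratiev_norm (-1) (- l - 4) u \<le> kondratiev_const l * kondratiev_norm (-1) (- l) f"
    if "chaos_solution A M f u" for u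
    by (rule kondratiev_estimate[OF assms(9,10)], rule rec[OF that])+
  \<comment> \<open>The only candidate is \<open>chaos_rec (inv A) M f\<close>; the estimate shows
    that it lies in the required space.\<close>
  show ?thesis
    using est unfolding chaos_solution_iff[OF bij] by auto
qed

end
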